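(* Let $G^g,G'^{g'},G''^{g''}$ be games with activeness with $G''^{g''}\in G'^{g'}\in G^g$. If $G^g=G''^{g''}$, then $G^g=((G\setminus\{G'^{g'}\})\cup G'')^g$.
   Context: Let $\mathcal{B}=\{0,1\}$. Define $\mathbb{I}_0=\{\emptyset\}\times\mathcal{B}$ and $\mathbb{I}_n=2^{\mathbb{I}_{n-1}}\times\mathcal{B}$ for $n\ge1$; a game with activeness is an element of $\mathbb{I}=\bigcup_{n\ge0}\mathbb{I}_n$. A pair $(G,g)$ is written $G^g$; elements of $G$ are its options (written $G'^{g'}\in G^g$), $g=1$ meaning active. The outcome $o$ is defined recursively: $o(G^g)=\mathscr{N}$ if $g=1$ and some option has outcome $\mathscr{P}$, and $o(G^g)=\mathscr{P}$ otherwise. The sum is $G^g+H^h=(\{G'^{g'}+H^h:G'^{g'}\in G^g\}\cup\{G^g+H'^{h'}:H'^{h'}\in H^h\})^{\max\{g,h\}}$. $G^g=H^h$ means $o(G^g+X^x)=o(H^h+X^x)$ for all games $X^x$. *)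

theory Defs
  imports Main "HOL-Library.FSet"
begin

text \<open>
  The levels \<open>\<bbbI>\<^sub>n\<close> are finite and cumulative, so their union consists of the hereditarily
  finite sets carrying an activeness bit at each node: it is the least solution of
  \<open>\<bbbI> = (finite subsets of \<bbbI>) \<times> {0, 1}\<close>, i.e. the datatype below (see \<open>game_level_exhaustive\<close>).
  \<open>Game G g\<close> is $G^g$, with \<open>True\<close> for 1 (active) and \<open>False\<close> for 0. HOL equality on
  \<open>game\<close> is identity of games; the equality of games that compares outcomes is \<open>game_eq\<close>.
\<close>

datatype game = Game (opts: "game fset") (active: bool)

primrec game_level :: "nat \<Rightarrow> game set" where
  "game_level 0 = {Game {||} b | b. True}"
| "game_level (Suc n) = {Game A b | A b. fset A \<subseteq> game_level n}"

lemma game_level_Suc_mono: "game_level n \<subseteq> game_level (Suc n)"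
proof (induction n)
  case (Suc n)
  then show ?case
    unfolding game_level.simps(2)[of "Suc n"] by (subst game_level.simps(2)) blast
qed auto

lemma game_level_mono: "m \<le> n \<Longrightarrow> game_level m \<subseteq> game_level n"
  by (rule lift_Suc_mono_le[of game_level]) (rule game_level_Suc_mono)

lemma game_level_exhaustive: "(\<Union>n. game_level n) = UNIV"
proof -
  have "\<exists>n. X \<in> game_level n" for X
  proof (induction X)
    case (Game A b)
    then obtain f where f: "\<And>Y. Y |\<in>| A \<Longrightarrow> Y \<in> game_level (f Y)"
      by metis
    have "Y \<in> game_level (Max (f ` fset A))" if "Y |\<in>| A" for Y
      using f[OF that] game_level_mono[of "f Y" "Max (f ` fset A)"] that by auto
    then have "Game A b \<in> game_level (Suc (Max (f ` fset A)))"
      by auto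
    then show ?case by blast
  qed
  then show ?thesis by auto
qed

lemma size_option_less:
  assumes "X |\<in>| A"
  shows "size X < size (Game A g)"
proof -
  have "size X < (\<Sum>Y\<in>fset A. Suc (size Y)) + 1"
    using member_le_sum[of X "fset A" "\<lambda>Y. Suc (size Y)"] assms by simp
  then show ?thesis by (simp add: size_fset_overloaded_simps)
qed

datatype outcome_class = \<N> | \<P>

function outcome :: "game \<Rightarrow> outcome_class" where
  "outcome (Game G g) = (if g \<and> (\<exists>X|\<in>|G. outcome X = \<P>) then \<N> else \<P>)"
  by pat_completeness auto
termination
  by (relation "measure size") (auto dest: size_option_less simp del: game.size)

function game_sum :: "game \<Rightarrow> game \<Rightarrow> game" (infixl \<open>\<oplus>\<close> 65) where
  "Game G g \<oplus> Game H h =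
     Game ((\<lambda>X. X \<oplus> Game H h) |`| G |\<union>| (\<lambda>Y. Game G g \<oplus> Y) |`| H) (max g h)"
  by pat_completeness auto
termination
  by (relation "measure (\<lambda>(X, Y). size X + size Y)")
    (auto dest: size_option_less simp del: game.size)

definition game_eq :: "game \<Rightarrow> game \<Rightarrow> bool" (infix \<open>\<doteq>\<close> 50) where
  "G \<doteq> H \<longleftrightarrow> (\<forall>X. outcome (G \<oplus> X) = outcome (H \<oplus> X))"

end

theory Submission
  imports Defs
begin

text \<open>
  Equal games have the same activeness. Hence, by induction on \<open>X\<close>, an equal pair
  \<open>G\<^sup>g\<close>, \<open>K\<^sup>k\<close> also equals \<open>H\<^sup>g\<close> whenever \<open>K \<subseteq> H \<subseteq> G \<union> K\<close>: a winning move in \<open>H + X\<close> wins in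
  \<open>G + X\<close> or in \<open>K + X\<close>, and every winning move in \<open>K + X\<close> is available in \<open>H + X\<close>.
\<close>

lemma outcome_sum_eq_N_iff:
  "outcome (Game G g \<oplus> Game H h) = \<N> \<longleftrightarrow>
    (g \<or> h) \<and> ((\<exists>Y|\<in>|G. outcome (Y \<oplus> Game H h) = \<P>) \<or> (\<exists>Y|\<in>|H. outcome (Game G g \<oplus> Y) = \<P>))"
  by (auto simp: max_def)

lemma outcome_neq_N_iff: "outcome X \<noteq> \<N> \<longleftrightarrow> outcome X = \<P>"
  by (cases "outcome X") auto

text \<open>For active \<open>G\<^sup>g\<close>, one of the inactive games \<open>{}\<close> and \<open>{{}}\<close> gives a sum of outcome \<open>\<N>\<close>.\<close>

lemma game_eq_imp_active:
  assumes "Game G g \<doteq> Game H h" and g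
  shows h
proof (rule ccontr)
  assume "\<not> h"
  have "outcome (Game G g \<oplus> Game A False) = \<P>" for A
    using assms(1) \<open>\<not> h\<close> outcome_sum_eq_N_iff[of H h A False]
    unfolding game_eq_def by (metis outcome_neq_N_iff)
  \<comment> \<open>The winning move is from \<open>{{}}\<close> to \<open>{}\<close>: it leaves a
    sum of outcome \<open>\<P>\<close>, by the previous fact with \<open>A\<close> empty.\<close>
  moreover from this have "outcome (Game G g \<oplus> Game {|Game {||} False|} False) = \<N>"
    using \<open>g\<close> by (subst outcome_sum_eq_N_iff) (simp del: outcome.simps game_sum.simps)
  ultimately show False by (metis outcome_class.distinct(1))
qed

lemma game_eq_sym: "X \<doteq> Y \<Longrightarrow> Y \<doteq> X"
  by (simp add: game_eq_def)

lemma game_eq_between: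
  assumes eq: "Game G g \<doteq> Game K k" and "K |\<subseteq>| H" and "H |\<subseteq>| G |\<union>| K"
  shows "Game G g \<doteq> Game H g"
proof -
  have "k = g"
    using game_eq_imp_active[OF eq] game_eq_imp_active[OF game_eq_sym[OF eq]] by blast
  with eq have eq: "outcome (Game G g \<oplus> X) = outcome (Game K g \<oplus> X)" for X
    by (simp add: game_eq_def)
  have "outcome (Game G g \<oplus> X) = outcome (Game H g \<oplus> X)" for X
  proof (induction X)
    case (Game A a)
    have "outcome (Game G g \<oplus> Game A a) = \<N> \<longleftrightarrow> outcome (Game H g \<oplus> Game A a) = \<N>"
    proof
      assume "outcome (Game G g \<oplus> Game A a) = \<N>"
      then have "outcome (Game K g \<oplus> Game A a) = \<N>"
        by (simp only: eq simp_thms)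
      \<comment> \<open>For a move to \<open>Y\<close> in \<open>A\<close>, \<open>eq\<close> passes
        from \<open>K + Y\<close> to \<open>G + Y\<close> and the induction hypothesis from there to
        \<open>H + Y\<close>.\<close>
      then show "outcome (Game H g \<oplus> Game A a) = \<N>"
        using \<open>K |\<subseteq>| H\<close> Game eq unfolding outcome_sum_eq_N_iff by (metis fsubsetD)
    next
      assume "outcome (Game H g \<oplus> Game A a) = \<N>"
      then have "outcome (Game G g \<oplus> Game A a) = \<N> \<or> outcome (Game K g \<oplus> Game A a) = \<N>"
        using \<open>H |\<subseteq>| G |\<union>| K\<close> Game unfolding outcome_sum_eq_N_iff
        by (metis fsubsetD funion_iff)
      then show "outcome (Game G g \<oplus> Game A a) = \<N>"
        by (simp only: eq simp_thms)
    qed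
    then show ?case by (metis outcome_neq_N_iff)
  qed
  then show ?thesis by (simp add: game_eq_def)
qed

theorem theorem3p38:
  fixes G G' G'' :: "game fset" and g g' g'' :: bool
  assumes "Game G'' g'' |\<in>| G'" and "Game G' g' |\<in>| G"
    and "Game G g \<doteq> Game G'' g''"
  shows "Game G g \<doteq> Game ((G |-| {|Game G' g'|}) |\<union>| G'') g"
  \<comment> \<open>Here \<open>K\<close> is \<open>G''\<close>: the new option set contains
    \<open>G''\<close> and lies within \<open>G |\<union>| G''\<close>.\<close>
  using assms(3) by (rule game_eq_between) auto

end
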